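(* The following four sets are maximal dense-lineable in $\ell_1$, $\ell_1$, $\omega$ and $\omega$, respectively: (a) the set of sequences in $\ell_1$ for whose generated series the ratio test fails; (b) the set of sequences in $\ell_1$ for whose generated series the root test fails; (c) the set of sequences in $\omega$ whose generated series diverges and for which the ratio test fails; (d) the set of sequences in $\omega$ whose generated series diverges and for which the root test fails.
   Context: $\omega=\mathbb{R}^{\mathbb{N}}$ is the space of all real sequences with the product topology. $\ell_1$ is the space of absolutely summable real sequences with the norm $\|(a_n)\|_1=\sum_{n\ge1}|a_n|$. The series generated by a real sequence $(a_n)$ is $\sum_n a_n$; a series is called divergent whenever it does not converge. Conventions for quotients: $a/0:=\infty$ for $a\in(0,\infty)$ and $0/0:=0$. The (refined) ratio test states: if $\limsup_{n\to\infty}|a_{n+1}|/|a_n|<1$ then $\sum_n a_n$ converges, and if $\liminf_{n\to\infty}|a_{n+1}|/|a_n|>1$ then $\sum_n a_n$ diverges. The (refined) root test states: if $\limsup_{n\to\infty}|a_n|^{1/n}<1$ then $\sum_n a_n$ converges, and if $\limsup_{n\to\infty}|a_n|^{1/n}>1$ then $\sum_n a_n$ diverges. A test fails for $\sum_n a_n$ if it provides no information, i.e. neither of its two hypotheses is satisfied: the ratio test fails when $\limsup_{n\to\infty}|a_{n+1}|/|a_n|\ge 1$ and $\liminf_{n\to\infty}|a_{n+1}|/|a_n|\le 1$; the root test fails when $\limsup_{n\to\infty}|a_n|^{1/n}=1$. A subset $A$ of a topological vector space $X$ is maximal dense-lineable in $X$ if there is a dense vector subspace $M$ of $X$ with $M\setminus\{0\}\subset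 A$ and $\dim(M)=\dim(X)$ (algebraic dimension). Both $\ell_1$ and $\omega$ have dimension $\mathfrak{c}$, the cardinality of the continuum. *)

theory Defs
  imports "HOL-Analysis.Analysis" "HOL-Library.Function_Algebras"
begin

text \<open>Addition and zero of functions are the pointwise ones of
  \<^theory>\<open>HOL-Library.Function_Algebras\<close>.\<close>

instantiation "fun" :: (type, real_vector) real_vector
begin

definition scaleR_fun :: "real \<Rightarrow> ('a \<Rightarrow> 'b) \<Rightarrow> 'a \<Rightarrow> 'b"
  where "scaleR_fun c f = (\<lambda>x. c *\<^sub>R f x)"

instance
  by standard (simp_all add: scaleR_fun_def fun_eq_iff algebra_simps)

end

lemma scaleR_fun_apply [simp]: "(c *\<^sub>R f) x = c *\<^sub>R f x"
  by (simp add: scaleR_fun_def)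


section \<open>Maximal dense-lineability\<close>

text \<open>A topological vector space is given by a topology \<open>X\<close> on a linear subspace
  \<open>topspace X\<close> of a real vector space.\<close>

definition tvs :: "'a::real_vector topology \<Rightarrow> bool"
  where "tvs X \<longleftrightarrow> subspace (topspace X) \<and>
    continuous_map (prod_topology X X) X (\<lambda>(x, y). x + y) \<and>
    continuous_map (prod_topology euclideanreal X) X (\<lambda>(c, x). c *\<^sub>R x)"

text \<open>The dimension of the library is a natural number, hence useless in infinite dimension.
  Since all Hamel bases of a space are equipotent, comparing one pair of them suffices.\<close>

definition same_dimension :: "'a::real_vector set \<Rightarrow> 'b::real_vector set \<Rightarrow> bool"
  where "same_dimension V W \<longleftrightarrow>
    (\<exists>B C. independent B \<and> span B = V \<and> independent C \<and> span C = W \<and> B \<approx> C)"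

definition maximal_dense_lineable :: "'a::real_vector topology \<Rightarrow> 'a set \<Rightarrow> bool"
  where "maximal_dense_lineable X A \<longleftrightarrow> tvs X \<and> A \<subseteq> topspace X \<and>
    (\<exists>M. subspace M \<and> M \<subseteq> topspace X \<and> X closure_of M = topspace X \<and>
         M - {0} \<subseteq> A \<and> same_dimension M (topspace X))"


section \<open>Sequence spaces\<close>

text \<open>A real sequence \<open>(a\<^sub>n)\<close>, \<open>n \<ge> 1\<close>, is a function \<open>a :: nat \<Rightarrow> real\<close> with
  \<open>a n\<close> standing for the term with index \<open>n + 1\<close>.\<close>

definition omega :: "(nat \<Rightarrow> real) topology"
  where "omega = product_topology (\<lambda>_. euclideanreal) UNIV"

definition l1_carrier :: "(nat \<Rightarrow> real) set"
  where "l1_carrier = {a. summable (\<lambda>n. \<bar>a n\<bar>)}"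

text \<open>The value outside \<open>l1_carrier\<close> is irrelevant; it is fixed because
  \<^locale>\<open>Metric_space\<close> wants the distance to be nonnegative on the whole type.\<close>

definition l1_norm :: "(nat \<Rightarrow> real) \<Rightarrow> real"
  where "l1_norm a = (if a \<in> l1_carrier then \<Sum>n. \<bar>a n\<bar> else 0)"

definition l1 :: "(nat \<Rightarrow> real) topology"
  where "l1 = Metric_space.mtopology l1_carrier (\<lambda>a b. l1_norm (a - b))"


section \<open>Ratio test and root test\<close>

text \<open>Division in \<^typ>\<open>ereal\<close> obeys the conventions \<open>x / 0 = \<infinity>\<close> for \<open>x > 0\<close> and \<open>0 / 0 = 0\<close>.\<close>

lemma ereal_quotient_conventions: "0 < x \<Longrightarrow> ereal x / ereal 0 = \<infinity>" and "ereal 0 / ereal 0 = 0"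
  by (simp_all add: divide_ereal_def)

definition ratio_test_fails :: "(nat \<Rightarrow> real) \<Rightarrow> bool"
  where "ratio_test_fails a \<longleftrightarrow>
    limsup (\<lambda>n. ereal \<bar>a (Suc n)\<bar> / ereal \<bar>a n\<bar>) \<ge> 1 \<and>
    liminf (\<lambda>n. ereal \<bar>a (Suc n)\<bar> / ereal \<bar>a n\<bar>) \<le> 1"

text \<open>The root has degree \<open>Suc n\<close> because \<open>a n\<close> is the term with index \<open>n + 1\<close>.\<close>

definition root_test_fails :: "(nat \<Rightarrow> real) \<Rightarrow> bool"
  where "root_test_fails a \<longleftrightarrow> limsup (\<lambda>n. ereal (root (Suc n) \<bar>a n\<bar>)) = 1"


section \<open>The sequence spaces are topological vector spaces\<close>

lemma topspace_omega [simp]: "topspace omega = UNIV"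
  by (simp add: omega_def)

lemma tvs_omega: "tvs omega"
proof -
  have *: "continuous_map (prod_topology omega omega) euclideanreal (\<lambda>x. fst x k)"
       "continuous_map (prod_topology omega omega) euclideanreal (\<lambda>x. snd x k)"
       "continuous_map (prod_topology euclideanreal omega) euclideanreal (\<lambda>x. snd x k)" for k
    using continuous_map_compose[OF continuous_map_fst continuous_map_product_projection[of k UNIV "\<lambda>_. euclideanreal"], of omega]
          continuous_map_compose[OF continuous_map_snd continuous_map_product_projection[of k UNIV "\<lambda>_. euclideanreal"]]
    by (simp_all add: o_def omega_def)
  have "continuous_map (prod_topology omega omega) omega (\<lambda>(x, y). x + y)"
    by (subst (3) omega_def)
       (auto simp: continuous_map_componentwise_UNIV case_prod_beta intro!: continuous_map_add *)
  moreover have "continuous_map (prod_topology euclideanreal omega) omega (\<lambda>(c, x). c *\<^sub>R x)"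
    by (subst (2) omega_def)
       (auto simp: continuous_map_componentwise_UNIV case_prod_beta
             intro!: continuous_map_real_mult continuous_map_fst *)
  ultimately show ?thesis
    by (simp add: tvs_def)
qed

lemma l1_carrier_add: "a \<in> l1_carrier \<Longrightarrow> b \<in> l1_carrier \<Longrightarrow> a + b \<in> l1_carrier"
  unfolding l1_carrier_def
  by (auto intro: summable_comparison_test'[OF summable_add, of "\<lambda>n. \<bar>a n\<bar>" "\<lambda>n. \<bar>b n\<bar>"])

lemma l1_carrier_scaleR: "a \<in> l1_carrier \<Longrightarrow> c *\<^sub>R a \<in> l1_carrier"
  unfolding l1_carrier_def by (simp add: abs_mult summable_mult)

lemma subspace_l1: "subspace l1_carrier"
  by (auto simp: subspace_def l1_carrier_add l1_carrier_scaleR) (simp add: l1_carrier_def)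

lemma l1_carrier_diff: "a \<in> l1_carrier \<Longrightarrow> b \<in> l1_carrier \<Longrightarrow> a - b \<in> l1_carrier"
  by (rule subspace_diff[OF subspace_l1])

lemma l1_norm_add:
  assumes "a \<in> l1_carrier" "b \<in> l1_carrier"
  shows "l1_norm (a + b) \<le> l1_norm a + l1_norm b"
proof -
  have ab: "a + b \<in> l1_carrier" using assms by (rule l1_carrier_add)
  have "(\<Sum>n. \<bar>(a + b) n\<bar>) \<le> (\<Sum>n. \<bar>a n\<bar> + \<bar>b n\<bar>)"
    using assms ab by (intro suminf_le summable_add) (auto simp: l1_carrier_def)
  also have "\<dots> = (\<Sum>n. \<bar>a n\<bar>) + (\<Sum>n. \<bar>b n\<bar>)"
    using assms by (intro suminf_add[symmetric]) (auto simp: l1_carrier_def)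
  finally show ?thesis using assms ab by (simp add: l1_norm_def)
qed

lemma l1_norm_scaleR: "a \<in> l1_carrier \<Longrightarrow> l1_norm (c *\<^sub>R a) = \<bar>c\<bar> * l1_norm a"
  using l1_carrier_scaleR[of a c]
  by (simp add: l1_norm_def) (simp add: l1_carrier_def abs_mult suminf_mult)

lemma l1_norm_nonneg: "l1_norm a \<ge> 0"
  by (simp add: l1_norm_def) (simp add: l1_carrier_def suminf_nonneg)

lemma l1_norm_eq_0: "a \<in> l1_carrier \<Longrightarrow> l1_norm a = 0 \<longleftrightarrow> a = 0"
  by (simp add: l1_norm_def) (simp add: l1_carrier_def suminf_eq_zero_iff fun_eq_iff)

lemma l1_norm_commute: "l1_norm (a - b) = l1_norm (b - a)"
  by (simp add: l1_norm_def l1_carrier_def abs_minus_commute)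

interpretation l1: Metric_space l1_carrier "\<lambda>a b. l1_norm (a - b)"
proof
  fix x y z
  show "0 \<le> l1_norm (x - y)" by (rule l1_norm_nonneg)
  show "l1_norm (x - y) = l1_norm (y - x)" by (rule l1_norm_commute)
  show "l1_norm (x - y) = 0 \<longleftrightarrow> x = y" if "x \<in> l1_carrier" "y \<in> l1_carrier"
    using l1_norm_eq_0[OF l1_carrier_diff[OF that]] by simp
  show "l1_norm (x - z) \<le> l1_norm (x - y) + l1_norm (y - z)"
    if "x \<in> l1_carrier" "y \<in> l1_carrier" "z \<in> l1_carrier"
    using l1_norm_add[OF l1_carrier_diff[OF that(1,2)] l1_carrier_diff[OF that(2,3)]]
    by simp
qed

lemma topspace_l1 [simp]: "topspace l1 = l1_carrier"
  by (simp add: l1_def)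

lemma tvs_l1: "tvs l1"
proof -
  have "continuous_map (prod_topology l1 l1) l1 (\<lambda>(x, y). x + y)"
    unfolding l1_def l1.continuous_map_to_metric
  proof (intro ballI allI impI)
    fix p and e :: real
    assume p: "p \<in> topspace (prod_topology l1.mtopology l1.mtopology)" and "e > 0"
    obtain x y where p_eq: "p = (x, y)" by fastforce
    have xy: "x \<in> l1_carrier" "y \<in> l1_carrier" using p by (auto simp: p_eq)
    let ?U = "l1.mball x (e/2) \<times> l1.mball y (e/2)"
    have "u + v \<in> l1.mball (x + y) e" if "(u, v) \<in> ?U" for u v
    proof -
      have uv: "u \<in> l1_carrier" "v \<in> l1_carrier" "l1_norm (x - u) < e/2" "l1_norm (y - v) < e/2"
        using that by auto
      have eq: "(x + y) - (u + v) = (x - u) + (y - v)" by simp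
      have "l1_norm ((x + y) - (u + v)) < e"
        unfolding eq
        using l1_norm_add[OF l1_carrier_diff l1_carrier_diff, OF xy(1) uv(1) xy(2) uv(2)] uv(3,4)
        by linarith
      then show ?thesis using xy uv by (simp add: l1_carrier_add)
    qed
    then show "\<exists>U. openin (prod_topology l1.mtopology l1.mtopology) U \<and> p \<in> U \<and>
        (\<forall>q\<in>U. (case q of (x, y) \<Rightarrow> x + y) \<in> l1.mball (case p of (x, y) \<Rightarrow> x + y) e)"
      using xy \<open>e > 0\<close> by (intro exI[of _ ?U]) (auto simp: p_eq openin_prod_Times_iff simp del: l1.in_mball intro: l1.centre_in_mball_iff[THEN iffD2])
  qed
  moreover have "continuous_map (prod_topology euclideanreal l1) l1 (\<lambda>(c, x). c *\<^sub>R x)"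
    unfolding l1_def l1.continuous_map_to_metric
  proof (intro ballI allI impI)
    fix p and e :: real
    assume p: "p \<in> topspace (prod_topology euclideanreal l1.mtopology)" and "e > 0"
    obtain c x where p_eq: "p = (c, x)" by fastforce
    have x: "x \<in> l1_carrier" using p by (auto simp: p_eq)
    define r where "r = e / 2 / (l1_norm x + 1)"
    define s where "s = e / 2 / (\<bar>c\<bar> + r)"
    have pos: "l1_norm x + 1 > 0" using l1_norm_nonneg[of x] by simp
    then have "r > 0" using \<open>e > 0\<close> by (simp add: r_def)
    then have "s > 0" using \<open>e > 0\<close> by (simp add: s_def add_nonneg_pos)
    have cancel: "w / z * z = w" if "z > 0" for w z :: real using that by simp
    let ?U = "ball c r \<times> l1.mball x s"
    have "d *\<^sub>R u \<in> l1.mball (c *\<^sub>R x) e" if "(d, u) \<in> ?U" for d u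
    proof -
      have u: "u \<in> l1_carrier" "l1_norm (x - u) < s" and d: "\<bar>c - d\<bar> < r"
        using that by (auto simp: dist_real_def)
      have xu: "x - u \<in> l1_carrier" using x u by (simp add: l1_carrier_diff)
      have "c *\<^sub>R x - d *\<^sub>R u = (c - d) *\<^sub>R x + d *\<^sub>R (x - u)"
        by (simp add: algebra_simps)
      then have "l1_norm (c *\<^sub>R x - d *\<^sub>R u) \<le> \<bar>c - d\<bar> * l1_norm x + \<bar>d\<bar> * l1_norm (x - u)"
        using l1_norm_add[OF l1_carrier_scaleR[OF x] l1_carrier_scaleR[OF xu], of "c - d" d]
        by (simp add: l1_norm_scaleR x xu)
      also have "\<bar>c - d\<bar> * l1_norm x \<le> r * l1_norm x"
        using d l1_norm_nonneg by (intro mult_right_mono) auto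
      also have "r * l1_norm x < r * (l1_norm x + 1)" using \<open>r > 0\<close> by simp
      also have "r * (l1_norm x + 1) = e / 2" unfolding r_def by (rule cancel[OF pos])
      also have "\<bar>d\<bar> * l1_norm (x - u) \<le> (\<bar>c\<bar> + r) * s"
        using d u l1_norm_nonneg \<open>r > 0\<close> by (intro mult_mono) auto
      also have "(\<bar>c\<bar> + r) * s = e / 2"
        using add_nonneg_pos[OF abs_ge_zero \<open>r > 0\<close>, of c] unfolding s_def
        by (subst mult.commute) (rule cancel)
      finally have "l1_norm (c *\<^sub>R x - d *\<^sub>R u) < e" by (simp only: field_sum_of_halves)
      then show ?thesis unfolding l1.in_mball using l1_carrier_scaleR[OF x] l1_carrier_scaleR[OF u(1)] by blast
    qed
    then show "\<exists>U. openin (prod_topology euclideanreal l1.mtopology) U \<and> p \<in> U \<and>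
        (\<forall>q\<in>U. (case q of (c, x) \<Rightarrow> c *\<^sub>R x) \<in> l1.mball (case p of (c, x) \<Rightarrow> c *\<^sub>R x) e)"
      using x \<open>s > 0\<close> \<open>r > 0\<close>
      by (intro exI[of _ ?U]) (auto simp: p_eq openin_prod_Times_iff simp del: l1.in_mball intro: l1.centre_in_mball_iff[THEN iffD2])
  qed
  ultimately show ?thesis
    by (simp add: tvs_def subspace_l1)
qed

end

theory Submission
  imports Defs "HOL-Real_Asymp.Real_Asymp"
begin

text \<open>The power sequences \<open>n powr \<tau>\<close> with distinct exponents are linearly independent, and a
  nontrivial linear combination of them is asymptotic to a nonzero multiple of the one with
  the largest exponent; this is stable under changing finitely many terms. For such a sequence both
  quotients and roots tend to \<open>1\<close>, and it does not tend to \<open>0\<close> if the exponent is positive.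
  Perturb the powers with exponents in an interval of length \<open>1\<close> by finitely supported sequences, in
  such a way that for every unit vector \<open>e\<close> and every \<open>j \<ge> 1\<close> one of the perturbations is \<open>j e\<close>.
  Scaling by \<open>1/j\<close> shows that the closure of the span contains all unit vectors, so the span is
  dense. Exponents in \<open>(-3, -2]\<close> serve for \<open>l\<^sub>1\<close>, exponents in \<open>(0, 1]\<close> for \<open>\<omega>\<close>.\<close>

lemma sum_fun_apply: "(\<Sum>i\<in>A. f i) x = (\<Sum>i\<in>A. f i x)"
  for f :: "'i \<Rightarrow> 'a \<Rightarrow> 'b::comm_monoid_add"
  by (induction A rule: infinite_finite_induct) auto


section \<open>Sequences of power growth\<close>

text \<open>Asymptotic equivalence to a nonzero multiple of the power with exponent
  \<open>\<tau>\<close>. The sign of \<open>c\<close> is left free because leading coefficients of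
  linear combinations may be negative.\<close>

definition power_growth :: "real \<Rightarrow> (nat \<Rightarrow> real) \<Rightarrow> bool"
  where "power_growth \<tau> a \<longleftrightarrow> (\<exists>c. c \<noteq> 0 \<and> (\<lambda>n. a n / real (Suc n) powr \<tau>) \<longlonglongrightarrow> c)"

lemma power_growth_abs:
  assumes "power_growth \<tau> a"
  obtains c where "c > 0" "(\<lambda>n. \<bar>a n\<bar> / real (Suc n) powr \<tau>) \<longlonglongrightarrow> c"
proof -
  obtain c where c: "c \<noteq> 0" "(\<lambda>n. a n / real (Suc n) powr \<tau>) \<longlonglongrightarrow> c"
    using assms by (auto simp: power_growth_def)
  show thesis
    using tendsto_rabs[OF c(2)] c(1) by (intro that[of "\<bar>c\<bar>"]) (auto simp: abs_divide)
qed

lemma power_growth_eventually_nonzero: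
  assumes "power_growth \<tau> a"
  shows "eventually (\<lambda>n. a n \<noteq> 0) sequentially"
proof -
  obtain c where c: "c > 0" "(\<lambda>n. \<bar>a n\<bar> / real (Suc n) powr \<tau>) \<longlonglongrightarrow> c"
    using power_growth_abs[OF assms] .
  have "eventually (\<lambda>n. \<bar>a n\<bar> / real (Suc n) powr \<tau> > 0) sequentially"
    using order_tendstoD(1)[OF c(2,1)] .
  then show ?thesis by eventually_elim auto
qed

lemma power_growth_not_0: "power_growth \<tau> a \<Longrightarrow> a \<noteq> 0"
  using power_growth_eventually_nonzero[of \<tau> a] by auto

text \<open>The quotient is that of two consecutive normalized terms, tending to
  \<open>c / c\<close>, times a fixed power of \<open>(n + 2) / (n + 1)\<close>, which tends to
  1.\<close>

lemma power_growth_ratio_tendsto: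
  assumes "power_growth \<tau> a"
  shows "(\<lambda>n. \<bar>a (Suc n)\<bar> / \<bar>a n\<bar>) \<longlonglongrightarrow> 1"
proof -
  obtain c where c: "c > 0" "(\<lambda>n. \<bar>a n\<bar> / real (Suc n) powr \<tau>) \<longlonglongrightarrow> c"
    using power_growth_abs[OF assms] .
  let ?q = "\<lambda>n. \<bar>a n\<bar> / real (Suc n) powr \<tau>"
  have "(\<lambda>n. real (Suc (Suc n)) / real (Suc n)) \<longlonglongrightarrow> 1" by real_asymp
  then have "(\<lambda>n. (real (Suc (Suc n)) / real (Suc n)) powr \<tau>) \<longlonglongrightarrow> 1 powr \<tau>"
    by (intro tendsto_powr) auto
  then have "(\<lambda>n. ?q (Suc n) / ?q n * (real (Suc (Suc n)) / real (Suc n)) powr \<tau>)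
      \<longlonglongrightarrow> c / c * 1 powr \<tau>"
    using c by (intro tendsto_mult tendsto_divide filterlim_compose[OF c(2) filterlim_Suc]) auto
  moreover have "?q (Suc n) / ?q n * (real (Suc (Suc n)) / real (Suc n)) powr \<tau>
      = \<bar>a (Suc n)\<bar> / \<bar>a n\<bar>" for n
    by (simp add: powr_divide)
  ultimately show ?thesis using c by simp
qed

lemma power_growth_ratio_test_fails:
  assumes "power_growth \<tau> a"
  shows "ratio_test_fails a"
proof -
  have "(\<lambda>n. ereal (\<bar>a (Suc n)\<bar> / \<bar>a n\<bar>)) \<longlonglongrightarrow> 1"
    using power_growth_ratio_tendsto[OF assms] by (simp add: one_ereal_def)
  \<comment> \<open>Real and extended real quotients differ where the denominator is 0, so they are
    identified only from the point on where \<open>a\<close> has no zeros.\<close>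
  moreover have "eventually (\<lambda>n. ereal (\<bar>a (Suc n)\<bar> / \<bar>a n\<bar>) = ereal \<bar>a (Suc n)\<bar> / ereal \<bar>a n\<bar>) sequentially"
    using power_growth_eventually_nonzero[OF assms] by eventually_elim auto
  ultimately have "(\<lambda>n. ereal \<bar>a (Suc n)\<bar> / ereal \<bar>a n\<bar>) \<longlonglongrightarrow> 1"
    by (rule Lim_transform_eventually)
  then show ?thesis
    by (simp add: ratio_test_fails_def lim_imp_Limsup lim_imp_Liminf)
qed

text \<open>The logarithm of the root is \<open>ln (?q n)\<close>, which is convergent, divided by
  \<open>n + 1\<close>, plus \<open>\<tau>\<close> times \<open>ln (n + 1) / (n + 1)\<close>; both
  parts tend to 0.\<close>

lemma power_growth_root_test_fails:
  assumes "power_growth \<tau> a"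
  shows "root_test_fails a"
proof -
  obtain c where c: "c > 0" "(\<lambda>n. \<bar>a n\<bar> / real (Suc n) powr \<tau>) \<longlonglongrightarrow> c"
    using power_growth_abs[OF assms] .
  let ?q = "\<lambda>n. \<bar>a n\<bar> / real (Suc n) powr \<tau>"
  have "(\<lambda>n. ln (?q n)) \<longlonglongrightarrow> ln c"
    using c by (intro tendsto_ln) auto
  moreover have "(\<lambda>n. 1 / real (Suc n)) \<longlonglongrightarrow> 0" "(\<lambda>n. ln (real (Suc n)) / real (Suc n)) \<longlonglongrightarrow> 0"
    by real_asymp+
  ultimately have "(\<lambda>n. exp (ln (?q n) * (1 / real (Suc n)) + \<tau> * (ln (real (Suc n)) / real (Suc n))))
      \<longlonglongrightarrow> exp (ln c * 0 + \<tau> * 0)"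
    by (intro tendsto_exp tendsto_add tendsto_mult tendsto_const)
  moreover have "eventually (\<lambda>n. exp (ln (?q n) * (1 / real (Suc n)) + \<tau> * (ln (real (Suc n)) / real (Suc n)))
      = root (Suc n) \<bar>a n\<bar>) sequentially"
    using power_growth_eventually_nonzero[OF assms]
    by eventually_elim
       (simp add: root_powr_inverse powr_def[of "\<bar>_\<bar>"] ln_div ln_powr add_divide_distrib[symmetric])
  ultimately have "(\<lambda>n. root (Suc n) \<bar>a n\<bar>) \<longlonglongrightarrow> exp (ln c * 0 + \<tau> * 0)"
    by (rule Lim_transform_eventually)
  then have "(\<lambda>n. ereal (root (Suc n) \<bar>a n\<bar>)) \<longlonglongrightarrow> 1"
    by (simp add: one_ereal_def)
  then show ?thesis
    by (simp add: root_test_fails_def lim_imp_Limsup)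
qed

text \<open>Terms tending to 0 would still tend to 0 after division by a growing power,
  contradicting the nonzero limit.\<close>

lemma power_growth_not_summable:
  assumes "power_growth \<tau> a" "\<tau> > 0"
  shows "\<not> summable a"
proof
  assume "summable a"
  then have "a \<longlonglongrightarrow> 0" by (rule summable_LIMSEQ_zero)
  moreover have "(\<lambda>n. real (Suc n) powr - \<tau>) \<longlonglongrightarrow> 0"
    using \<open>\<tau> > 0\<close> by real_asymp
  ultimately have "(\<lambda>n. a n * real (Suc n) powr - \<tau>) \<longlonglongrightarrow> 0 * 0"
    by (rule tendsto_mult)
  then have "(\<lambda>n. a n / real (Suc n) powr \<tau>) \<longlonglongrightarrow> 0"
    by (simp add: powr_minus divide_inverse)
  then show False
    using assms(1) LIMSEQ_unique by (auto simp: power_growth_def)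
qed

text \<open>Divided by the power with the largest exponent that really occurs, all other summands
  vanish in the limit and its coefficient remains. Only eventual equality with powers is asked, so
  finitely supported perturbations are harmless.\<close>

lemma power_growth_sum:
  assumes "finite S" "s0 \<in> S" "r s0 \<noteq> 0"
    and f: "\<And>s. s \<in> S \<Longrightarrow> eventually (\<lambda>n. f s n = real (Suc n) powr (\<sigma> + s)) sequentially"
  shows "\<exists>s\<in>S. power_growth (\<sigma> + s) (\<Sum>s\<in>S. r s *\<^sub>R f s)"
proof -
  \<comment> \<open>Zero coefficients are discarded first, so that the coefficient at the maximum,
    which becomes the limit, is nonzero.\<close>
  define S' where "S' = {s \<in> S. r s \<noteq> 0}"
  define m where "m = Max S'"
  have S': "finite S'" "S' \<noteq> {}" using assms by (auto simp: S'_def)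
  have m: "m \<in> S'" using Max_in[OF S'] by (simp add: m_def)
  have le: "s \<le> m" if "s \<in> S'" for s using S' that by (simp add: m_def)
  have sum_eq: "(\<Sum>s\<in>S. r s *\<^sub>R f s) = (\<Sum>s\<in>S'. r s *\<^sub>R f s)"
    using \<open>finite S\<close> by (intro sum.mono_neutral_right) (auto simp: S'_def)
  have "(\<lambda>n. r s * (f s n / real (Suc n) powr (\<sigma> + m))) \<longlonglongrightarrow> (if s = m then r m else 0)"
    if s: "s \<in> S'" for s
  proof -
    have "(\<lambda>n. real (Suc n) powr (s - m)) \<longlonglongrightarrow> (if s = m then 1 else 0)"
    proof (cases "s = m")
      case False
      then have "s - m < 0" using le[OF s] by simp
      then have "(\<lambda>n. real (Suc n) powr (s - m)) \<longlonglongrightarrow> 0" by real_asymp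
      then show ?thesis using False by simp
    qed simp
    moreover have "eventually (\<lambda>n. real (Suc n) powr (s - m) = f s n / real (Suc n) powr (\<sigma> + m)) sequentially"
      using f[of s] s unfolding S'_def
      by (auto elim!: eventually_mono simp: powr_diff powr_add)
    ultimately have "(\<lambda>n. f s n / real (Suc n) powr (\<sigma> + m)) \<longlonglongrightarrow> (if s = m then 1 else 0)"
      by (rule Lim_transform_eventually)
    then have "(\<lambda>n. r s * (f s n / real (Suc n) powr (\<sigma> + m))) \<longlonglongrightarrow> r s * (if s = m then 1 else 0)"
      by (intro tendsto_mult tendsto_const)
    then show ?thesis by (simp split: if_splits)
  qed
  then have "(\<lambda>n. \<Sum>s\<in>S'. r s * (f s n / real (Suc n) powr (\<sigma> + m))) \<longlonglongrightarrow> (\<Sum>s\<in>S'. if s = m then r m else 0)"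
    by (rule tendsto_sum)
  also have "(\<Sum>s\<in>S'. if s = m then r m else 0) = r m" using S' m by simp
  finally have "(\<lambda>n. (\<Sum>s\<in>S. r s *\<^sub>R f s) n / real (Suc n) powr (\<sigma> + m)) \<longlonglongrightarrow> r m"
    unfolding sum_eq by (simp add: sum_fun_apply sum_divide_distrib)
  then show ?thesis
    using m by (intro bexI[of _ m]) (auto simp: power_growth_def S'_def)
qed


section \<open>Perturbed powers\<close>

definition unit_seq :: "nat \<Rightarrow> nat \<Rightarrow> real"
  where "unit_seq k = (\<lambda>n. if n = k then 1 else 0)"

definition power_seq :: "real \<Rightarrow> nat \<Rightarrow> real"
  where "power_seq \<tau> = (\<lambda>n. real (Suc n) powr \<tau>)"

text \<open>For \<open>s\<close> in \<open>(0, 1]\<close> the number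
  \<open>nat \<lfloor>1 / s\<rfloor>\<close> runs through all positive integers; decoded as a pair
  it prescribes a position \<open>k\<close> and a height \<open>j\<close>.\<close>

definition bump :: "real \<Rightarrow> nat \<Rightarrow> real"
  where "bump s = (case prod_decode (nat \<lfloor>1 / s\<rfloor>) of (k, j) \<Rightarrow> real j *\<^sub>R unit_seq k)"

definition bumped_power :: "real \<Rightarrow> real \<Rightarrow> nat \<Rightarrow> real"
  where "bumped_power \<sigma> s = power_seq (\<sigma> + s) + bump s"

lemma ex_bump: "\<exists>s\<in>{0<..1}. bump s = real (Suc j) *\<^sub>R unit_seq k"
proof -
  \<comment> \<open>The positive height \<open>Suc j\<close> makes the code \<open>p\<close>
    positive, so \<open>1 / p\<close> lies in \<open>(0, 1]\<close> and its reciprocal returns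
    \<open>p\<close>.\<close>
  define p where "p = prod_encode (k, Suc j)"
  have "p \<ge> 1" using le_prod_encode_2[of "Suc j" k] by (simp add: p_def)
  moreover have "prod_decode p = (k, Suc j)" by (simp add: p_def)
  ultimately show ?thesis
    by (intro bexI[of _ "1 / real p"]) (auto simp: bump_def)
qed

lemma bumped_power_eventually_power:
  "eventually (\<lambda>n. bumped_power \<sigma> s n = real (Suc n) powr (\<sigma> + s)) sequentially"
proof -
  obtain k j where "prod_decode (nat \<lfloor>1 / s\<rfloor>) = (k, j)" by fastforce
  then show ?thesis
    using eventually_gt_at_top[of k]
    by (auto elim!: eventually_mono simp: bumped_power_def bump_def unit_seq_def power_seq_def)
qed

text \<open>The difference of two members with distinct parameters has power growth, hence is
  nonzero. Independence of the image as a set would not exclude coincidences.\<close>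

lemma inj_bumped_power: "inj (bumped_power \<sigma>)"
proof (rule injI, rule ccontr)
  fix s t assume eq: "bumped_power \<sigma> s = bumped_power \<sigma> t" and "s \<noteq> t"
  define r where "r x = (if x = s then 1 else - 1 :: real)" for x
  have "(\<Sum>x\<in>{s, t}. r x *\<^sub>R bumped_power \<sigma> x) = 0"
    using eq \<open>s \<noteq> t\<close> by (simp add: r_def)
  moreover have "\<exists>x\<in>{s, t}. power_growth (\<sigma> + x) (\<Sum>x\<in>{s, t}. r x *\<^sub>R bumped_power \<sigma> x)"
    by (rule power_growth_sum[where ?s0.0 = s, OF _ _ _ bumped_power_eventually_power])
       (auto simp: r_def)
  ultimately show False using power_growth_not_0 by auto
qed

text \<open>Injectivity turns combinations over sets of vectors, as in \<open>span\<close> and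
  \<open>independent\<close>, into combinations indexed by exponents, as in
  \<open>power_growth_sum\<close>.\<close>

lemma finite_subset_image_bumped_power:
  assumes "finite T" "T \<subseteq> bumped_power \<sigma> ` I"
  obtains S where "finite S" "S \<subseteq> I" "T = bumped_power \<sigma> ` S"
    "\<And>r. (\<Sum>v\<in>T. r v *\<^sub>R v) = (\<Sum>s\<in>S. r (bumped_power \<sigma> s) *\<^sub>R bumped_power \<sigma> s)"
proof -
  obtain S where S: "S \<subseteq> I" "finite S" "T = bumped_power \<sigma> ` S"
    using finite_subset_image[OF assms] by auto
  then show thesis
    using inj_on_subset[OF inj_bumped_power]
    by (intro that[of S]) (auto simp: sum.reindex)
qed

lemma independent_bumped_power: "independent (bumped_power \<sigma> ` I)"
  unfolding independent_explicit_finite_subsets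
proof (intro allI impI ballI, rule ccontr)
  fix T r v
  assume T: "T \<subseteq> bumped_power \<sigma> ` I" "finite T" and sum: "(\<Sum>v\<in>T. r v *\<^sub>R v) = 0"
    and v: "v \<in> T" "r v \<noteq> 0"
  obtain S where S: "finite S" "S \<subseteq> I" "T = bumped_power \<sigma> ` S"
    "\<And>r. (\<Sum>v\<in>T. r v *\<^sub>R v) = (\<Sum>s\<in>S. r (bumped_power \<sigma> s) *\<^sub>R bumped_power \<sigma> s)"
    using finite_subset_image_bumped_power[OF T(2,1)] by blast
  obtain s0 where "s0 \<in> S" "v = bumped_power \<sigma> s0" using v S by auto
  then have "\<exists>s\<in>S. power_growth (\<sigma> + s) (\<Sum>s\<in>S. r (bumped_power \<sigma> s) *\<^sub>R bumped_power \<sigma> s)"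
    using S v
    by (intro power_growth_sum[where ?s0.0 = s0, OF _ _ _ bumped_power_eventually_power]) auto
  then show False using power_growth_not_0 sum S(4) by auto
qed

text \<open>A nonzero vector has a nonzero coefficient, so the dominant exponent exists and comes
  from \<open>I\<close>. This controls all nonzero elements of the dense subspace at once.\<close>

lemma span_bumped_power_growth:
  assumes "a \<in> span (bumped_power \<sigma> ` I)" "a \<noteq> 0"
  shows "\<exists>s\<in>I. power_growth (\<sigma> + s) a"
proof -
  obtain T r where T: "finite T" "T \<subseteq> bumped_power \<sigma> ` I" and a: "a = (\<Sum>v\<in>T. r v *\<^sub>R v)"
    using assms(1) by (auto simp: span_explicit)
  obtain S where S: "finite S" "S \<subseteq> I"
    "\<And>r. (\<Sum>v\<in>T. r v *\<^sub>R v) = (\<Sum>s\<in>S. r (bumped_power \<sigma> s) *\<^sub>R bumped_power \<sigma> s)"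
    using finite_subset_image_bumped_power[OF T] by blast
  have a': "a = (\<Sum>s\<in>S. r (bumped_power \<sigma> s) *\<^sub>R bumped_power \<sigma> s)" using a S(3) by simp
  obtain s0 where "s0 \<in> S" "r (bumped_power \<sigma> s0) \<noteq> 0"
    using assms(2) unfolding a' by (metis (no_types, lifting) scaleR_eq_0_iff sum.neutral)
  then have "\<exists>s\<in>S. power_growth (\<sigma> + s) a"
    unfolding a' using S
    by (intro power_growth_sum[where ?s0.0 = s0, OF _ _ _ bumped_power_eventually_power]) auto
  then show ?thesis using S by blast
qed


section \<open>Dimension\<close>

text \<open>Reals are coded as sets of naturals by \<open>g\<close>; a sequence of such sets becomes
  one set of coded pairs \<open>(k, m)\<close>, with \<open>m\<close> in the set of index
  \<open>k\<close>.\<close>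

lemma real_sequences_lepoll_reals: "(UNIV :: (nat \<Rightarrow> real) set) \<lesssim> (UNIV :: real set)"
proof -
  obtain g :: "real \<Rightarrow> nat set" where g: "inj g"
    using eqpoll_imp_lepoll[OF eqpoll_sym[OF nat_sets_eqpoll_reals]] by (auto simp: lepoll_def)
  have "inj (\<lambda>a :: nat \<Rightarrow> real. {p. snd (prod_decode p) \<in> g (a (fst (prod_decode p)))})"
  proof (rule injI, rule ext)
    fix a b :: "nat \<Rightarrow> real" and k
    assume eq: "{p. snd (prod_decode p) \<in> g (a (fst (prod_decode p)))} =
        {p. snd (prod_decode p) \<in> g (b (fst (prod_decode p)))}"
    have "m \<in> g (a k) \<longleftrightarrow> m \<in> g (b k)" for m
      using eq[THEN eqset_imp_iff, of "prod_encode (k, m)"] by simp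
    then show "a k = b k" using g by (auto simp: inj_def)
  qed
  then have "(UNIV :: (nat \<Rightarrow> real) set) \<lesssim> (UNIV :: nat set set)"
    by (auto simp: lepoll_def)
  then show ?thesis by (rule lepoll_trans2[OF _ nat_sets_eqpoll_reals])
qed

text \<open>Extend \<open>B\<close> to a Hamel basis \<open>C\<close> of \<open>V\<close>. Then
  \<open>C\<close> is at least as large as \<open>B\<close>, and at most as large because there are
  only continuum many real sequences.\<close>

lemma same_dimension_span_continuum:
  fixes B V :: "(nat \<Rightarrow> real) set"
  assumes "independent B" "B \<subseteq> V" "subspace V" "(UNIV :: real set) \<lesssim> B"
  shows "same_dimension (span B) V"
proof -
  obtain C where C: "B \<subseteq> C" "C \<subseteq> V" "independent C" "V \<subseteq> span C"
    using maximal_independent_subset_extend[OF assms(2,1)] .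
  have "span C = V"
    using C span_minimal[OF C(2) assms(3)] by blast
  moreover have "C \<lesssim> B"
    using lepoll_trans[OF subset_imp_lepoll[OF subset_UNIV]
        lepoll_trans[OF real_sequences_lepoll_reals assms(4)]] .
  ultimately show ?thesis
    using C assms lepoll_antisym[OF subset_imp_lepoll] unfolding same_dimension_def by blast
qed


section \<open>Density\<close>

text \<open>The closure of a product is the product of the closures, and continuous operations that
  map into \<open>M\<close> map this closure into the closure of \<open>M\<close>.\<close>

lemma subspace_closure_of:
  assumes "tvs X" "subspace M" "M \<subseteq> topspace X"
  shows "subspace (X closure_of M)"
proof (rule subspaceI)
  show "0 \<in> X closure_of M"
    using closure_of_subset[OF assms(3)] subspace_0[OF assms(2)] by blast
next
  fix x y assume "x \<in> X closure_of M" "y \<in> X closure_of M"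
  then have "(x, y) \<in> prod_topology X X closure_of (M \<times> M)"
    by (simp add: closure_of_Times)
  moreover have "continuous_map (prod_topology X X) X (\<lambda>(x, y). x + y)"
    using assms(1) by (simp add: tvs_def)
  ultimately have "x + y \<in> X closure_of ((\<lambda>(x, y). x + y) ` (M \<times> M))"
    using continuous_map_image_closure_subset by blast
  moreover have "(\<lambda>(x, y). x + y) ` (M \<times> M) \<subseteq> M"
    using assms(2) by (auto intro: subspace_add)
  ultimately show "x + y \<in> X closure_of M"
    using closure_of_mono by blast
next
  fix c x assume "x \<in> X closure_of M"
  then have "(c, x) \<in> prod_topology euclideanreal X closure_of (UNIV \<times> M)"
    by (simp add: closure_of_Times)
  moreover have "continuous_map (prod_topology euclideanreal X) X (\<lambda>(c, x). c *\<^sub>R x)"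
    using assms(1) by (simp add: tvs_def)
  ultimately have "c *\<^sub>R x \<in> X closure_of ((\<lambda>(c, x). c *\<^sub>R x) ` (UNIV \<times> M))"
    using continuous_map_image_closure_subset by blast
  moreover have "(\<lambda>(c, x). c *\<^sub>R x) ` (UNIV \<times> M) \<subseteq> M"
    using assms(2) by (auto intro: subspace_scale)
  ultimately show "c *\<^sub>R x \<in> X closure_of M"
    using closure_of_mono by blast
qed

text \<open>The topology enters through two limits: \<open>shrink\<close> puts unit vectors into the
  closure, \<open>trunc\<close> then everything else. The exponents \<open>s j\<close> in
  \<open>shrink\<close> are arbitrary in \<open>(0, 1]\<close>, as they are dictated by the coding
  in \<open>bump\<close>.\<close>

lemma closure_of_span_bumped_power:
  assumes X: "tvs X" "bumped_power \<sigma> ` {0<..1} \<subseteq> topspace X"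
    and shrink: "\<And>k s. range s \<subseteq> {0<..1} \<Longrightarrow>
      limitin X (\<lambda>j. unit_seq k + (1 / real (Suc j)) *\<^sub>R power_seq (\<sigma> + s j)) (unit_seq k) sequentially"
    and trunc: "\<And>x. x \<in> topspace X \<Longrightarrow> limitin X (\<lambda>N. \<Sum>k<N. x k *\<^sub>R unit_seq k) x sequentially"
  shows "X closure_of span (bumped_power \<sigma> ` {0<..1}) = topspace X"
proof
  let ?M = "span (bumped_power \<sigma> ` {0<..1})"
  have M: "?M \<subseteq> topspace X"
    using X by (intro span_minimal) (auto simp: tvs_def)
  have sub: "subspace (X closure_of ?M)"
    by (rule subspace_closure_of[OF X(1) subspace_span M])
  have unit: "unit_seq k \<in> X closure_of ?M" for k
  proof -
    obtain s where s: "\<And>j. s j \<in> {0<..1}" "\<And>j. bump (s j) = real (Suc j) *\<^sub>R unit_seq k"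
      using choice[of "\<lambda>j t. t \<in> {0<..1} \<and> bump t = real (Suc j) *\<^sub>R unit_seq k"] ex_bump by blast
    have "unit_seq k + (1 / real (Suc j)) *\<^sub>R power_seq (\<sigma> + s j) \<in> ?M" for j
    proof -
      have "unit_seq k + (1 / real (Suc j)) *\<^sub>R power_seq (\<sigma> + s j)
          = (1 / real (Suc j)) *\<^sub>R bumped_power \<sigma> (s j)"
        unfolding bumped_power_def s(2) scaleR_add_right by simp
      also have "\<dots> \<in> ?M" using s(1) by (intro span_scale span_base) auto
      finally show ?thesis .
    qed
    then show ?thesis
      using s closure_of_subset[OF M]
      by (intro limitin_closedin[OF shrink[of s k]]) (auto intro!: always_eventually)
  qed
  show "topspace X \<subseteq> X closure_of ?M"
  proof
    fix x assume x: "x \<in> topspace X"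
    have "(\<Sum>k<N. x k *\<^sub>R unit_seq k) \<in> X closure_of ?M" for N
      using unit by (intro subspace_sum[OF sub] subspace_scale[OF sub])
    then show "x \<in> X closure_of ?M"
      by (intro limitin_closedin[OF trunc[OF x]]) auto
  qed
qed (rule closure_of_subset_topspace)

lemma maximal_dense_lineable_power_growth:
  assumes X: "tvs X" "bumped_power \<sigma> ` {0<..1} \<subseteq> topspace X"
    and dense: "X closure_of span (bumped_power \<sigma> ` {0<..1}) = topspace X"
    and P: "\<And>a s. s \<in> {0<..1} \<Longrightarrow> power_growth (\<sigma> + s) a \<Longrightarrow> P a"
  shows "maximal_dense_lineable X {a \<in> topspace X. P a}"
proof -
  let ?B = "bumped_power \<sigma> ` {0<..1}"
  have V: "subspace (topspace X)" using X by (simp add: tvs_def)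
  have M: "span ?B \<subseteq> topspace X"
    using X V by (intro span_minimal) auto
  \<comment> \<open>The exponents form a set of size continuum, and injectivity carries this over to
    \<open>?B\<close>.\<close>
  have "{0<..1::real} \<approx> (UNIV :: real set)" by (rule eqpoll_real_subset[of 0 1]) auto
  then have "(UNIV :: real set) \<lesssim> ?B"
    using inj_on_subset[OF inj_bumped_power]
    by (simp add: eqpoll_imp_lepoll eqpoll_sym)
  then have "same_dimension (span ?B) (topspace X)"
    using X V by (intro same_dimension_span_continuum independent_bumped_power)
  moreover have "span ?B - {0} \<subseteq> {a \<in> topspace X. P a}"
    using span_bumped_power_growth P M by blast
  ultimately show ?thesis
    using X M dense unfolding maximal_dense_lineable_def by blast
qed

section \<open>The two limits in \<open>omega\<close> and in \<open>l1\<close>\<close>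

lemma sum_unit_seq: "(\<Sum>k<N. x k *\<^sub>R unit_seq k) = (\<lambda>n. if n < N then x n else 0)"
  by (auto simp: fun_eq_iff sum_fun_apply unit_seq_def if_distrib cong: if_cong)

text \<open>Convergence is coordinatewise, and exponents at most 1 bound coordinate \<open>n\<close>
  of every power by \<open>n + 1\<close>, uniformly in \<open>j\<close>; the factor
  \<open>1 / (j + 1)\<close> then forces the limit 0.\<close>

lemma closure_of_span_bumped_power_omega:
  "omega closure_of span (bumped_power 0 ` {0<..1}) = topspace omega"
proof (rule closure_of_span_bumped_power[OF tvs_omega])
  fix k :: nat and s :: "nat \<Rightarrow> real"
  assume "range s \<subseteq> {0<..1}"
  then have s: "s j \<le> 1" for j by (auto simp: image_subset_iff)
  have "(\<lambda>j. unit_seq k n + 1 / real (Suc j) * power_seq (s j) n) \<longlonglongrightarrow> unit_seq k n + 0" for n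
  proof (rule tendsto_add[OF tendsto_const],
      rule Lim_null_comparison[where g = "\<lambda>j. 1 / real (Suc j) * real (Suc n)"])
    have "real (Suc n) powr s j \<le> real (Suc n) powr 1" for j
      using s by (intro powr_mono) auto
    then show "\<forall>\<^sub>F j in sequentially. norm (1 / real (Suc j) * power_seq (s j) n) \<le> 1 / real (Suc j) * real (Suc n)"
      by (auto simp: power_seq_def abs_mult divide_right_mono)
    show "(\<lambda>j. 1 / real (Suc j) * real (Suc n)) \<longlonglongrightarrow> 0" by real_asymp
  qed
  then show "limitin omega (\<lambda>j. unit_seq k + (1 / real (Suc j)) *\<^sub>R power_seq (0 + s j)) (unit_seq k) sequentially"
    by (simp add: omega_def limitin_componentwise)
next
  fix x :: "nat \<Rightarrow> real"
  have "(\<lambda>N. if n < N then x n else 0) \<longlonglongrightarrow> x n" for n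
    by (intro tendsto_eventually eventually_mono[OF eventually_gt_at_top[of n]]) simp
  then show "limitin omega (\<lambda>N. \<Sum>k<N. x k *\<^sub>R unit_seq k) x sequentially"
    by (simp add: sum_unit_seq omega_def limitin_componentwise)
qed simp

lemma unit_seq_l1: "unit_seq k \<in> l1_carrier"
  by (auto simp: l1_carrier_def unit_seq_def intro!: summable_finite[of "{k}"])

lemma power_seq_le_inverse_square: "\<tau> \<le> -2 \<Longrightarrow> \<bar>power_seq \<tau> n\<bar> \<le> 1 / (real (Suc n))\<^sup>2"
  using powr_mono[of \<tau> "-2" "real (Suc n)"]
  by (simp add: power_seq_def powr_minus_divide)

lemma summable_inverse_square: "summable (\<lambda>n. 1 / (real (Suc n))\<^sup>2)"
  using inverse_squares_sums by (auto simp: sums_iff)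

lemma power_seq_l1: "\<tau> \<le> -2 \<Longrightarrow> power_seq \<tau> \<in> l1_carrier"
  unfolding l1_carrier_def mem_Collect_eq
  by (rule summable_comparison_test'[OF summable_inverse_square, of 0])
     (simp add: power_seq_le_inverse_square del: of_nat_Suc)

text \<open>One bound for all exponents up to \<open>-2\<close>, needed because the exponent varies
  along the approximating sequence.\<close>

lemma l1_norm_power_seq_le: "\<tau> \<le> -2 \<Longrightarrow> l1_norm (power_seq \<tau>) \<le> (\<Sum>n. 1 / (real (Suc n))\<^sup>2)"
  using power_seq_l1[of \<tau>] power_seq_le_inverse_square[of \<tau>] summable_inverse_square
  by (simp add: l1_norm_def) (auto simp: l1_carrier_def intro!: suminf_le)

text \<open>The shift \<open>-3\<close> keeps the exponents at most \<open>-2\<close>, within reach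
  of the inverse squares.\<close>

lemma bumped_power_l1: "s \<le> 1 \<Longrightarrow> bumped_power (-3) s \<in> l1_carrier"
  unfolding bumped_power_def bump_def
  by (auto intro!: l1_carrier_add l1_carrier_scaleR power_seq_l1 unit_seq_l1 split: prod.split)

text \<open>The truncation error is the tail of \<open>x\<close>, so its norm is the total sum minus
  a partial sum and tends to 0.\<close>

lemma l1_norm_truncation:
  assumes "x \<in> l1_carrier"
  shows "l1_norm ((\<Sum>k<N. x k *\<^sub>R unit_seq k) - x) = (\<Sum>n. \<bar>x n\<bar>) - (\<Sum>n<N. \<bar>x n\<bar>)"
proof -
  have sx: "summable (\<lambda>n. \<bar>x n\<bar>)" using assms by (simp add: l1_carrier_def)
  have "(\<Sum>k<N. x k *\<^sub>R unit_seq k) - x \<in> l1_carrier"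
    by (intro l1_carrier_diff assms subspace_sum[OF subspace_l1] l1_carrier_scaleR unit_seq_l1)
  then have "l1_norm ((\<Sum>k<N. x k *\<^sub>R unit_seq k) - x) = (\<Sum>n. \<bar>if n < N then 0 else x n\<bar>)"
    by (simp add: l1_norm_def sum_unit_seq) (rule suminf_cong, simp)
  also have "\<dots> = (\<Sum>n. \<bar>x n\<bar> - (if n \<in> {..<N} then \<bar>x n\<bar> else 0))"
    by (intro suminf_cong) auto
  also have "\<dots> = (\<Sum>n. \<bar>x n\<bar>) - (\<Sum>n<N. \<bar>x n\<bar>)"
    using sums_diff[OF summable_sums[OF sx] sums_If_finite_set[of "{..<N}" "\<lambda>n. \<bar>x n\<bar>"]]
    by (simp add: sums_iff)
  finally show ?thesis .
qed

lemma closure_of_span_bumped_power_l1: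
  "l1 closure_of span (bumped_power (-3) ` {0<..1}) = topspace l1"
proof (rule closure_of_span_bumped_power[OF tvs_l1])
  show "bumped_power (-3) ` {0<..1} \<subseteq> topspace l1"
    by (auto simp: bumped_power_l1)
next
  fix k :: nat and s :: "nat \<Rightarrow> real"
  assume "range s \<subseteq> {0<..1}"
  then have s: "s j \<le> 1" for j by (auto simp: image_subset_iff)
  let ?f = "\<lambda>j. (1 / real (Suc j)) *\<^sub>R power_seq (-3 + s j)"
  let ?K = "\<Sum>n. 1 / (real (Suc n))\<^sup>2"
  have f: "power_seq (-3 + s j) \<in> l1_carrier" "?f j \<in> l1_carrier" for j
    using s[of j] by (auto intro!: power_seq_l1 l1_carrier_scaleR)
  have "(\<lambda>j. l1_norm (?f j)) \<longlonglongrightarrow> 0"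
  proof (rule Lim_null_comparison[where g = "\<lambda>j. 1 / real (Suc j) * ?K"])
    have "l1_norm (?f j) \<le> 1 / real (Suc j) * ?K" for j
      unfolding l1_norm_scaleR[OF f(1)]
      using l1_norm_power_seq_le[of "-3 + s j"] s[of j] by (intro mult_mono l1_norm_nonneg) auto
    then show "\<forall>\<^sub>F j in sequentially. norm (l1_norm (?f j)) \<le> 1 / real (Suc j) * ?K"
      by (simp add: l1_norm_nonneg)
    show "(\<lambda>j. 1 / real (Suc j) * ?K) \<longlonglongrightarrow> 0"
      by (rule tendsto_mult_left_zero) real_asymp
  qed
  then show "limitin l1 (\<lambda>j. unit_seq k + ?f j) (unit_seq k) sequentially"
    using f unit_seq_l1[of k]
    by (simp add: l1_def l1.limitin_metric_dist_null l1_carrier_add)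
next
  fix x assume "x \<in> topspace l1"
  then have x: "x \<in> l1_carrier" by simp
  then have "(\<lambda>N. (\<Sum>n. \<bar>x n\<bar>) - (\<Sum>n<N. \<bar>x n\<bar>)) \<longlonglongrightarrow> (\<Sum>n. \<bar>x n\<bar>) - (\<Sum>n. \<bar>x n\<bar>)"
    by (intro tendsto_diff tendsto_const summable_LIMSEQ) (simp add: l1_carrier_def)
  moreover have "(\<Sum>k<N. x k *\<^sub>R unit_seq k) \<in> l1_carrier" for N
    by (intro subspace_sum[OF subspace_l1] l1_carrier_scaleR unit_seq_l1)
  ultimately show "limitin l1 (\<lambda>N. \<Sum>k<N. x k *\<^sub>R unit_seq k) x sequentially"
    using x by (simp add: l1_def l1.limitin_metric_dist_null l1_norm_truncation)
qed

theorem theorem6p2: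
  shows "maximal_dense_lineable l1 {a \<in> topspace l1. ratio_test_fails a} \<and>
    maximal_dense_lineable l1 {a \<in> topspace l1. root_test_fails a} \<and>
    maximal_dense_lineable omega {a \<in> topspace omega. \<not> summable a \<and> ratio_test_fails a} \<and>
    maximal_dense_lineable omega {a \<in> topspace omega. \<not> summable a \<and> root_test_fails a}"
proof -
  \<comment> \<open>Both tests fail for every growth exponent; absolute convergence is already
    contained in membership in \<open>l1\<close>.\<close>
  have l1: "maximal_dense_lineable l1 {a \<in> topspace l1. P a}"
    if "\<And>\<tau> a. power_growth \<tau> a \<Longrightarrow> P a" for P
    using that by (intro maximal_dense_lineable_power_growth[OF tvs_l1 _ closure_of_span_bumped_power_l1])
      (auto simp: bumped_power_l1)
  \<comment> \<open>With \<open>\<sigma> = 0\<close> all exponents are positive, which is what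
    divergence rests on.\<close>
  have omega: "maximal_dense_lineable omega {a \<in> topspace omega. P a}"
    if "\<And>\<tau> a. \<tau> > 0 \<Longrightarrow> power_growth \<tau> a \<Longrightarrow> P a" for P
    by (rule maximal_dense_lineable_power_growth[OF tvs_omega _ closure_of_span_bumped_power_omega])
      (use that in auto)
  show ?thesis
    by (intro conjI l1 omega)
      (auto dest: power_growth_ratio_test_fails power_growth_root_test_fails power_growth_not_summable)
qed

end
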